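(* Let $w_1\in\mathbb{Z}_p$, $r\in\mathbb{N}$, $\delta_1\in\mathbb{Z}$, $n\in\mathbb{Z}_+$ and $x\in\mathbb{Z}_p$. Then $$\beta_{n,q}^{(r)}(x\mid \underbrace{w_1,\dots,w_1}_{r\text{ times}}:\delta_1,\delta_1+1,\dots,\delta_1+r-1)=\frac{1}{(1-q)^n}\sum_{l=0}^n\binom nl(-1)^lq^{lx}\,\frac{\binom{lw_1+\delta_1+r-1}{r}}{\binom{lw_1+\delta_1+r-1}{r}_q}\,\frac{r!}{[r]_q!}.$$
   Context: $p$ is a fixed prime, $\mathbb{N}=\{1,2,\dots\}$, $\mathbb{Z}_+=\mathbb{N}\cup\{0\}$, and $\mathbb{C}_p$ is the completion of an algebraic closure of $\mathbb{Q}_p$, with $|p|_p=p^{-1}$. $q\in\mathbb{C}_p$ satisfies $|1-q|_p<1$ and is not a root of unity. For $x\in\mathbb{Z}_p$, $q^x=\sum_{k\ge0}\binom xk(q-1)^k$ and $[x]_q=\frac{1-q^x}{1-q}$; $0^0=1$. $[r]_q!=[r]_q[r-1]_q\cdots[1]_q$, and for $m\in\mathbb{Z}_p$, $\binom{m}{r}_q=\frac{[m]_q[m-1]_q\cdots[m-r+1]_q}{[r]_q!}$ and $\binom mr=\frac{m(m-1)\cdots(m-r+1)}{r!}$. The expression $\frac{\binom mr}{\binom mr_q}\frac{r!}{[r]_q!}$ means $\prod_{j=1}^r\frac{m-j+1}{[m-j+1]_q}$, where a factor $\frac{0}{[0]_q}$ is read as its limiting value $\frac{q-1}{\log q}$ ($\log$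 the $p$-adic logarithm). The $p$-adic $q$-integral is $\int_{\mathbb{Z}_p}g(x)\,d\mu_q(x)=\lim_{N\to\infty}\frac{1}{[p^N]_q}\sum_{x=0}^{p^N-1}g(x)q^x$ (when the limit exists); multiple integrals are iterated. For $w_1,\dots,w_r\in\mathbb{Z}_p$ and $\delta_1,\dots,\delta_r\in\mathbb{Z}$, the Barnes' type multiple $q$-Bernoulli polynomials are $$\beta_{n,q}^{(r)}(x\mid w_1,\dots,w_r:\delta_1,\dots,\delta_r)=\int_{\mathbb{Z}_p}\cdots\int_{\mathbb{Z}_p}[w_1x_1+\cdots+w_rx_r+x]_q^n\,q^{\sum_{j=1}^r(\delta_j-1)x_j}\,d\mu_q(x_1)\cdots d\mu_q(x_r)\quad(r\text{ integrals}).$$ *)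

theory Defs
  imports
    "HOL-Analysis.Elementary_Metric_Spaces"
    "HOL-Computational_Algebra.Computational_Algebra"
begin

(* The library class real_normed_field is archimedean (it contains the reals isometrically) and
   the constant norm is reserved for real normed vector spaces, hence this separate class. *)
class complete_nonarch_field = field_char_0 + complete_space +
  fixes vnorm :: "'a \<Rightarrow> real"
  assumes dist_vnorm: "dist x y = vnorm (x - y)"
    and vnorm_mult: "vnorm (x * y) = vnorm x * vnorm y"
    and vnorm_add_ultrametric: "vnorm (x + y) \<le> max (vnorm x) (vnorm y)"

text \<open>In a complete field whose absolute value restricts to the p-adic one on the rational numbers,
  the topological closure of the rationals is the field of p-adic numbers.\<close>

definition Qp :: "'a::complete_nonarch_field set" where
  "Qp = closure (range of_rat)"

definition Zp :: "'a::complete_nonarch_field set" where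
  "Zp = {x \<in> Qp. vnorm x \<le> 1}"

definition Qp_alg :: "'a::complete_nonarch_field set" where
  "Qp_alg = {x. \<exists>P. P \<noteq> 0 \<and> (\<forall>i. coeff P i \<in> Qp) \<and> poly P x = 0}"

text \<open>The field \<open>'a\<close> is the completion of an algebraic closure of the p-adic numbers, with
  \<open>vnorm p = 1 / p\<close>. It is complete by its class. By multiplicativity, the
  first condition says that the norm restricts to the p-adic absolute value on the rationals; the
  second says that the set of elements algebraic over the p-adic numbers is algebraically closed,
  and the third that it is dense. This determines \<open>'a\<close> up to isometric isomorphism.\<close>

definition is_padic_complex :: "nat \<Rightarrow> 'a::complete_nonarch_field itself \<Rightarrow> bool" where
  "is_padic_complex p _ \<longleftrightarrow>
     (\<forall>k::int. k \<noteq> 0 \<longrightarrow> vnorm (of_int k :: 'a) = (1 / real p) ^ multiplicity (int p) k) \<and>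
     (\<forall>P::'a poly. (\<forall>i. coeff P i \<in> Qp_alg) \<and> degree P > 0 \<longrightarrow> (\<exists>x\<in>Qp_alg. poly P x = 0)) \<and>
     closure Qp_alg = (UNIV :: 'a set)"

definition padic_log :: "'a::complete_nonarch_field \<Rightarrow> 'a" where
  "padic_log z = (\<Sum>k. (- 1) ^ k * (z - 1) ^ Suc k / of_nat (Suc k))"

definition qpow :: "'a::complete_nonarch_field \<Rightarrow> 'a \<Rightarrow> 'a" where
  "qpow q x = (\<Sum>k. (x gchoose k) * (q - 1) ^ k)"

definition qnum :: "'a::complete_nonarch_field \<Rightarrow> 'a \<Rightarrow> 'a" where
  "qnum q x = (1 - qpow q x) / (1 - q)"

definition qfact :: "'a::complete_nonarch_field \<Rightarrow> nat \<Rightarrow> 'a" where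
  "qfact q r = (\<Prod>j=1..r. qnum q (of_nat j))"

definition qbinomial :: "'a::complete_nonarch_field \<Rightarrow> 'a \<Rightarrow> nat \<Rightarrow> 'a" where
  "qbinomial q m r = (\<Prod>j=1..r. qnum q (m - of_nat j + 1)) / qfact q r"

text \<open>The quotient of \<open>y\<close> by its q-analogue, extended to \<open>y = 0\<close> by its limit.\<close>

definition num_over_qnum :: "'a::complete_nonarch_field \<Rightarrow> 'a \<Rightarrow> 'a" where
  "num_over_qnum q y = (if y = 0 then (q - 1) / padic_log q else y / qnum q y)"

text \<open>The product of \<open>(m gchoose r) / qbinomial q m r\<close> and \<open>fact r / qfact q r\<close>, where each
  factor 0 / 0 is given its limiting value; see \<open>binomial_ratio_eq\<close> below for the case
  without such factors.\<close>

definition binomial_ratio :: "'a::complete_nonarch_field \<Rightarrow> 'a \<Rightarrow> nat \<Rightarrow> 'a" where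
  "binomial_ratio q m r = (\<Prod>j=1..r. num_over_qnum q (m - of_nat j + 1))"

lemma qpow_of_nat: "qpow q (of_nat n) = q ^ n"
proof -
  have "qpow q (of_nat n) = (\<Sum>k\<le>n. (of_nat n gchoose k) * (q - 1) ^ k)"
    unfolding qpow_def
    by (rule suminf_finite) (auto simp: binomial_gbinomial [symmetric])
  also have "\<dots> = ((q - 1) + 1) ^ n"
    by (subst binomial_ring) (simp add: binomial_gbinomial)
  finally show ?thesis by simp
qed

lemma binomial_ratio_eq:
  fixes q m :: "'a::complete_nonarch_field"
  assumes root: "\<And>k::nat. k > 0 \<Longrightarrow> q ^ k \<noteq> 1"
    and nz: "\<And>j. j \<in> {1..r} \<Longrightarrow> m - of_nat j + 1 \<noteq> 0"
  shows "binomial_ratio q m r = (m gchoose r) / qbinomial q m r * (fact r / qfact q r)"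
proof -
  have "qnum q (of_nat j) \<noteq> 0" if "j > 0" for j
    using root [OF that] root [of 1] by (simp add: qnum_def qpow_of_nat)
  then have qf: "qfact q r \<noteq> 0"
    by (simp add: qfact_def)
  have "(\<Prod>i=0..<r. m - of_nat i) = (\<Prod>j=1..r. m - of_nat j + 1)"
    by (rule prod.reindex_bij_witness [where i = "\<lambda>j. j - 1" and j = Suc]) auto
  then have gb: "m gchoose r = (\<Prod>j=1..r. m - of_nat j + 1) / fact r"
    by (simp add: gbinomial_prod_rev)
  have "binomial_ratio q m r = (\<Prod>j=1..r. (m - of_nat j + 1) / qnum q (m - of_nat j + 1))"
    unfolding binomial_ratio_def
    by (rule prod.cong) (use nz in \<open>auto simp: num_over_qnum_def\<close>)
  also have "\<dots> = (\<Prod>j=1..r. m - of_nat j + 1) / (\<Prod>j=1..r. qnum q (m - of_nat j + 1))"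
    by (rule prod_dividef)
  finally show ?thesis
    using qf by (simp add: gb qbinomial_def)
qed

definition q_integral_sums ::
    "nat \<Rightarrow> 'a::complete_nonarch_field \<Rightarrow> ('a \<Rightarrow> 'a) \<Rightarrow> nat \<Rightarrow> 'a" where
  "q_integral_sums p q g N =
     1 / qnum q (of_nat (p ^ N)) * (\<Sum>x<p ^ N. g (of_nat x) * qpow q (of_nat x))"

definition q_integrable ::
    "nat \<Rightarrow> 'a::complete_nonarch_field \<Rightarrow> ('a \<Rightarrow> 'a) \<Rightarrow> bool" where
  "q_integrable p q g \<longleftrightarrow> convergent (q_integral_sums p q g)"

definition q_integral ::
    "nat \<Rightarrow> 'a::complete_nonarch_field \<Rightarrow> ('a \<Rightarrow> 'a) \<Rightarrow> 'a" where
  "q_integral p q g = lim (q_integral_sums p q g)"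

text \<open>Iterated integral over the variables \<open>X 1, \<dots>, X r\<close>, with \<open>X 1\<close> innermost; the other
  values of \<open>X\<close> are kept.\<close>

primrec q_integral_iter ::
    "nat \<Rightarrow> 'a::complete_nonarch_field \<Rightarrow> nat \<Rightarrow> ((nat \<Rightarrow> 'a) \<Rightarrow> 'a) \<Rightarrow> (nat \<Rightarrow> 'a) \<Rightarrow> 'a" where
  "q_integral_iter p q 0 f X = f X"
| "q_integral_iter p q (Suc r) f X =
     q_integral p q (\<lambda>t. q_integral_iter p q r f (X(Suc r := t)))"

text \<open>Existence of all the limits in the iterated integral, for all p-adic integer values of the
  outer variables.\<close>

primrec q_integrable_iter ::
    "nat \<Rightarrow> 'a::complete_nonarch_field \<Rightarrow> nat \<Rightarrow> ((nat \<Rightarrow> 'a) \<Rightarrow> 'a) \<Rightarrow> (nat \<Rightarrow> 'a) \<Rightarrow> bool" where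
  "q_integrable_iter p q 0 f X \<longleftrightarrow> True"
| "q_integrable_iter p q (Suc r) f X \<longleftrightarrow>
     (\<forall>t\<in>Zp. q_integrable_iter p q r f (X(Suc r := t))) \<and>
     q_integrable p q (\<lambda>t. q_integral_iter p q r f (X(Suc r := t)))"

definition barnes_integrand ::
    "'a::complete_nonarch_field \<Rightarrow> nat \<Rightarrow> nat \<Rightarrow> 'a \<Rightarrow> (nat \<Rightarrow> 'a) \<Rightarrow> (nat \<Rightarrow> int) \<Rightarrow> (nat \<Rightarrow> 'a) \<Rightarrow> 'a" where
  "barnes_integrand q r n x w \<delta> X =
     qnum q ((\<Sum>j=1..r. w j * X j) + x) ^ n * qpow q (\<Sum>j=1..r. of_int (\<delta> j - 1) * X j)"

text \<open>Only the values of \<open>w\<close> and \<open>\<delta>\<close> at the indices \<open>1, \<dots>, r\<close> matter.\<close>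

definition barnes_q_bernoulli ::
    "nat \<Rightarrow> 'a::complete_nonarch_field \<Rightarrow> nat \<Rightarrow> nat \<Rightarrow> 'a \<Rightarrow> (nat \<Rightarrow> 'a) \<Rightarrow> (nat \<Rightarrow> int) \<Rightarrow> 'a" where
  "barnes_q_bernoulli p q r n x w \<delta> =
     q_integral_iter p q r (barnes_integrand q r n x w \<delta>) (\<lambda>_. 0)"

definition barnes_q_bernoulli_exists ::
    "nat \<Rightarrow> 'a::complete_nonarch_field \<Rightarrow> nat \<Rightarrow> nat \<Rightarrow> 'a \<Rightarrow> (nat \<Rightarrow> 'a) \<Rightarrow> (nat \<Rightarrow> int) \<Rightarrow> bool" where
  "barnes_q_bernoulli_exists p q r n x w \<delta> \<longleftrightarrow>
     q_integrable_iter p q r (barnes_integrand q r n x w \<delta>) (\<lambda>_. 0)"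

end

theory Submission
  imports Defs "HOL-Analysis.Uniform_Limit" "HOL-Number_Theory.Cong"
begin

text \<open>Expanding the \<open>n\<close>-th power of the bracket by the binomial theorem writes the integrand as a
  linear combination, over \<open>l = 0, \<dots>, n\<close>, of products of exponentials
  \<open>q ^ (c\<^sub>1 X\<^sub>1) * \<dots> * q ^ (c\<^sub>r X\<^sub>r)\<close> with \<open>c\<^sub>j = l * w\<^sub>j + \<delta>\<^sub>j - 1\<close> (lemma
  \<open>barnes_integrand_expand\<close>). The iterated integral of such a product is the product of the
  integrals of the single exponentials (\<open>q_integral_iter_qpow_sum\<close>), and these are computed
  explicitly (\<open>q_integral_qpow_LIMSEQ\<close>): with \<open>y = c + 1\<close>, the approximating sums are geometric
  and equal
    \<open>(1 - q) / (1 - q ^ y) * ((q ^ y) ^ (p ^ N) - 1) / (q ^ (p ^ N) - 1)\<close>.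
  The second quotient tends to \<open>y\<close>, so the integral is \<open>y / [y]\<close>; for \<open>y = 0\<close> the sums are
  \<open>(q - 1) * p ^ N / (q ^ (p ^ N) - 1)\<close> and tend to \<open>(q - 1) / log q\<close>. For equal \<open>w\<^sub>j\<close> and
  consecutive \<open>\<delta>\<^sub>j\<close> the numbers \<open>y\<^sub>1, \<dots>, y\<^sub>r\<close> are consecutive, and the product of the
  \<open>y\<^sub>j / [y\<^sub>j]\<close> is the ratio of binomial coefficients in the theorem.

  The analysis rests on three facts. The natural numbers are dense in \<open>Zp\<close>
  (\<open>Zp_eq_closure_of_nat\<close>), and series \<open>\<Sum>k. (x gchoose k) * c k\<close> with \<open>c k\<close> tending to \<open>0\<close>
  are continuous there (\<open>continuous_on_mahler_series\<close>). Hence \<open>x \<mapsto> q ^ x\<close> is continuous and its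
  functional equations follow from those for natural exponents. Next, \<open>q ^ (y * p ^ N)\<close> is the
  \<open>y\<close>-th power of \<open>q ^ (p ^ N)\<close>, a number close to \<open>1\<close>, and the binomial series to first order
  gives the limit \<open>y\<close> above (\<open>qpow_diff_ratio_LIMSEQ\<close>); as a by-product, \<open>q ^ y = 1\<close> only for
  \<open>y = 0\<close>. Finally, the absorption identity for binomial coefficients exhibits
  \<open>(q ^ m - 1) / m\<close> as the value at \<open>m - 1\<close> of a Mahler series whose value at \<open>- 1\<close> is the
  logarithm series, so that the case \<open>y = 0\<close> is again an instance of continuity
  (\<open>log_LIMSEQ\<close>). The limit is nonzero because raising an element close enough to \<open>1\<close> to the
  \<open>p\<close>-th power divides its distance from \<open>1\<close> by exactly \<open>p\<close> (\<open>vnorm_qp_diff_Suc\<close>).\<close>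

section \<open>Ultrametric fields as topological rings\<close>

lemma vnorm_0 [simp]: "vnorm (0::'a::complete_nonarch_field) = 0"
  using dist_vnorm [of "0::'a" 0] by simp

lemma vnorm_eq_0_iff [simp]: "vnorm x = 0 \<longleftrightarrow> (x::'a::complete_nonarch_field) = 0"
  using dist_vnorm [of x 0] by (metis diff_zero dist_eq_0_iff)

lemma vnorm_nonneg [simp]: "vnorm (x::'a::complete_nonarch_field) \<ge> 0"
  using dist_vnorm [of x 0] by (metis diff_zero zero_le_dist)

lemma vnorm_pos_iff: "vnorm x > 0 \<longleftrightarrow> (x::'a::complete_nonarch_field) \<noteq> 0"
  using vnorm_nonneg [of x] by (simp add: less_le)

lemma vnorm_1 [simp]: "vnorm (1::'a::complete_nonarch_field) = 1"
  using vnorm_mult [of "1::'a" 1] by simp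

lemma vnorm_minus_commute: "vnorm (x - y) = vnorm (y - x :: 'a::complete_nonarch_field)"
  by (metis dist_commute dist_vnorm)

lemma vnorm_minus [simp]: "vnorm (- x) = vnorm (x :: 'a::complete_nonarch_field)"
  using vnorm_minus_commute [of 0 x] by simp

lemma vnorm_power: "vnorm (x ^ n) = vnorm (x :: 'a::complete_nonarch_field) ^ n"
  by (induction n) (simp_all add: vnorm_mult)

lemma vnorm_divide: "vnorm (x / y) = vnorm x / vnorm (y :: 'a::complete_nonarch_field)"
proof (cases "y = 0")
  case False
  then show ?thesis
    using vnorm_mult [of "x / y" y] by simp
qed simp

lemma vnorm_add_le:
  "vnorm x \<le> e \<Longrightarrow> vnorm y \<le> e \<Longrightarrow> vnorm (x + y :: 'a::complete_nonarch_field) \<le> e"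
  using vnorm_add_ultrametric [of x y] by simp

lemma vnorm_add_less:
  "vnorm x < e \<Longrightarrow> vnorm y < e \<Longrightarrow> vnorm (x + y :: 'a::complete_nonarch_field) < e"
  using vnorm_add_ultrametric [of x y] by simp

lemma vnorm_diff_le:
  "vnorm x \<le> e \<Longrightarrow> vnorm y \<le> e \<Longrightarrow> vnorm (x - y :: 'a::complete_nonarch_field) \<le> e"
  using vnorm_add_le [of x e "- y"] by simp

lemma vnorm_sum_le:
  fixes f :: "'b \<Rightarrow> 'a::complete_nonarch_field"
  assumes "\<And>i. i \<in> A \<Longrightarrow> vnorm (f i) \<le> e" and "e \<ge> 0"
  shows "vnorm (sum f A) \<le> e"
  using assms by (induction A rule: infinite_finite_induct) (auto intro: vnorm_add_le)

lemma vnorm_sum_less: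
  fixes f :: "'b \<Rightarrow> 'a::complete_nonarch_field"
  assumes "\<And>i. i \<in> A \<Longrightarrow> vnorm (f i) < e" and "e > 0"
  shows "vnorm (sum f A) < e"
  using assms by (induction A rule: infinite_finite_induct) (auto intro: vnorm_add_less)

lemma vnorm_of_nat_le_1: "vnorm (of_nat n :: 'a::complete_nonarch_field) \<le> 1"
  by (induction n) (auto intro: vnorm_add_le)

text \<open>In an ultrametric triangle the two longest sides are equal.\<close>

lemma vnorm_eqI:
  fixes x y :: "'a::complete_nonarch_field"
  assumes "vnorm (x - y) < vnorm y"
  shows "vnorm x = vnorm y"
proof (rule antisym)
  show "vnorm x \<le> vnorm y"
    using vnorm_add_le [of "x - y" "vnorm y" y] assms by simp
  show "vnorm y \<le> vnorm x"
    using vnorm_add_ultrametric [of "y - x" x] assms vnorm_minus_commute [of x y] by simp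
qed

text \<open>The ring operations are continuous. Recording this as class inclusions gives access to the
  limit rules for sums, products and powers.\<close>

instance complete_nonarch_field \<subseteq> topological_ab_group_add
proof
  fix a b :: 'a
  have f: "(fst \<longlongrightarrow> a) (nhds a \<times>\<^sub>F nhds b)" and s: "(snd \<longlongrightarrow> b) (nhds a \<times>\<^sub>F nhds b)"
    by (rule filterlim_fst filterlim_snd)+
  show "LIM x (nhds a \<times>\<^sub>F nhds b). fst x + snd x :> nhds (a + b)"
  proof (rule tendstoI)
    fix e :: real assume e: "e > 0"
    show "\<forall>\<^sub>F x in nhds a \<times>\<^sub>F nhds b. dist (fst x + snd x) (a + b) < e"
      using tendstoD [OF f e] tendstoD [OF s e]
    proof eventually_elim
      case (elim x)
      have "(fst x + snd x) - (a + b) = (fst x - a) + (snd x - b)"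
        by simp
      with elim show ?case
        unfolding dist_vnorm by (metis vnorm_add_less)
    qed
  qed
  show "(uminus \<longlongrightarrow> - a) (nhds a)"
  proof (rule tendstoI)
    fix e :: real assume e: "e > 0"
    have "(id \<longlongrightarrow> a) (nhds a)"
      by (simp add: filterlim_def filtermap_id)
    from tendstoD [OF this e] show "\<forall>\<^sub>F x in nhds a. dist (- x) (- a) < e"
    proof eventually_elim
      case (elim x)
      have "- x - - a = - (x - a)"
        by simp
      with elim show ?case
        unfolding dist_vnorm by (metis vnorm_minus id_apply)
    qed
  qed
qed

instance complete_nonarch_field \<subseteq> topological_comm_monoid_mult
proof
  fix a b :: 'a
  have f: "(fst \<longlongrightarrow> a) (nhds a \<times>\<^sub>F nhds b)" and s: "(snd \<longlongrightarrow> b) (nhds a \<times>\<^sub>F nhds b)"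
    by (rule filterlim_fst filterlim_snd)+
  show "LIM x (nhds a \<times>\<^sub>F nhds b). fst x * snd x :> nhds (a * b)"
  proof (rule tendstoI)
    fix e :: real assume e: "e > 0"
    define d where "d = min 1 (e / (1 + vnorm a + vnorm b))"
    have pos: "1 + vnorm a + vnorm b > 0"
      by (smt (verit) vnorm_nonneg)
    with e have d: "d > 0" "d \<le> 1"
      unfolding d_def by simp_all
    have "d \<le> e / (1 + vnorm a + vnorm b)"
      unfolding d_def by simp
    with pos have de: "d * (1 + vnorm a + vnorm b) \<le> e"
      by (simp add: pos_le_divide_eq)
    have small: "u * v < e" if "0 \<le> u" "u < d" "0 \<le> v" "v \<le> 1 + vnorm a + vnorm b" for u v
    proof (cases "v = 0")
      case False
      then have "u * v < d * v"
        using that by simp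
      also have "\<dots> \<le> d * (1 + vnorm a + vnorm b)"
        using that d by simp
      finally show ?thesis using de by simp
    qed (use e in simp)
    show "\<forall>\<^sub>F x in nhds a \<times>\<^sub>F nhds b. dist (fst x * snd x) (a * b) < e"
      using tendstoD [OF f d(1)] tendstoD [OF s d(1)]
    proof eventually_elim
      case (elim x)
      \<comment> \<open>Products of small errors are controlled by taking both errors at most \<open>1\<close>; this is why
        \<open>d\<close> is capped at \<open>1\<close>.\<close>
      have split: "fst x * snd x - a * b =
          (fst x - a) * (snd x - b) + ((snd x - b) * a + (fst x - a) * b)"
        by (simp add: algebra_simps)
      have 1: "vnorm (fst x - a) < d" "vnorm (snd x - b) < d"
        using elim by (auto simp: dist_vnorm)
      have "vnorm (snd x - b) \<le> 1 + vnorm a + vnorm b"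
        using 1 d vnorm_nonneg [of a] vnorm_nonneg [of b] by linarith
      then show ?case
        unfolding dist_vnorm split
        using 1 by (intro vnorm_add_less) (auto simp: vnorm_mult intro!: small)
    qed
  qed
qed

lemma tendsto_vnorm_iff:
  fixes f :: "'b \<Rightarrow> 'a::complete_nonarch_field"
  shows "(f \<longlongrightarrow> l) F \<longleftrightarrow> ((\<lambda>x. vnorm (f x - l)) \<longlongrightarrow> 0) F"
  using tendsto_dist_iff [of f l F] by (simp add: dist_vnorm)

text \<open>The absolute value is locally constant away from \<open>0\<close>; continuity of division follows
  because the denominators eventually have a fixed absolute value.\<close>

lemma eventually_vnorm_eq:
  fixes f :: "'b \<Rightarrow> 'a::complete_nonarch_field"
  assumes "(f \<longlongrightarrow> l) F" and "l \<noteq> 0"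
  shows "\<forall>\<^sub>F x in F. vnorm (f x) = vnorm l"
proof -
  have "vnorm l > 0"
    using assms(2) by (simp add: vnorm_pos_iff)
  from tendstoD [OF assms(1) this] show ?thesis
    by eventually_elim (auto simp: dist_vnorm intro: vnorm_eqI)
qed

lemma tendsto_divide_nonarch:
  fixes f g :: "'b \<Rightarrow> 'a::complete_nonarch_field"
  assumes f: "(f \<longlongrightarrow> a) F" and g: "(g \<longlongrightarrow> b) F" and b: "b \<noteq> 0"
  shows "((\<lambda>x. f x / g x) \<longlongrightarrow> a / b) F"
proof -
  have "((\<lambda>x. vnorm (g x - b) / (vnorm b)\<^sup>2) \<longlongrightarrow> 0 / (vnorm b)\<^sup>2) F"
    using g b by (intro tendsto_divide tendsto_const) (auto simp: tendsto_vnorm_iff)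
  moreover have "\<forall>\<^sub>F x in F. vnorm (g x - b) / (vnorm b)\<^sup>2 = vnorm (inverse (g x) - inverse b)"
    using eventually_vnorm_eq [OF g b]
  proof eventually_elim
    case (elim x)
    then have "g x \<noteq> 0"
      using b by auto
    then have "inverse (g x) - inverse b = (b - g x) / (g x * b)"
      using b by (simp add: field_simps)
    then show ?case
      using elim by (simp add: vnorm_divide vnorm_mult power2_eq_square vnorm_minus_commute)
  qed
  ultimately have "((\<lambda>x. vnorm (inverse (g x) - inverse b)) \<longlongrightarrow> 0) F"
    by (simp add: tendsto_cong)
  then have "((\<lambda>x. inverse (g x)) \<longlongrightarrow> inverse b) F"
    by (simp add: tendsto_vnorm_iff)
  from tendsto_mult [OF f this] show ?thesis
    by (simp add: divide_inverse)
qed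

text \<open>A block of consecutive terms is no larger than its largest term, so the partial sums are
  Cauchy as soon as the terms tend to \<open>0\<close>.\<close>

lemma summable_nonarch:
  fixes f :: "nat \<Rightarrow> 'a::complete_nonarch_field"
  assumes "f \<longlonglongrightarrow> 0"
  shows "summable f"
proof -
  have "Cauchy (\<lambda>n. sum f {..<n})"
  proof (rule CauchyI')
    fix e :: real assume e: "e > 0"
    obtain K where K: "\<And>k. k \<ge> K \<Longrightarrow> vnorm (f k) < e"
      using tendstoD [OF assms e] by (auto simp: eventually_sequentially dist_vnorm)
    show "\<exists>M. \<forall>m\<ge>M. \<forall>n>m. dist (sum f {..<m}) (sum f {..<n}) < e"
    proof (intro exI [of _ K] allI impI)
      fix m n assume m: "K \<le> m" and n: "m < n"
      have "sum f {..<n} - sum f {..<m} = sum f {m..<n}"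
        using sum_diff_nat_ivl [of 0 m n f] n by (simp add: atLeast0LessThan)
      moreover have "vnorm (sum f {m..<n}) < e"
        using K m e by (intro vnorm_sum_less) auto
      ultimately show "dist (sum f {..<m}) (sum f {..<n}) < e"
        by (simp add: dist_vnorm vnorm_minus_commute [of "sum f {..<m}"])
    qed
  qed
  then show ?thesis
    by (simp add: summable_iff_convergent Cauchy_convergent_iff)
qed

lemma vnorm_limit_le:
  fixes X :: "nat \<Rightarrow> 'a::complete_nonarch_field"
  assumes "X \<longlonglongrightarrow> L" and "\<forall>\<^sub>F n in sequentially. vnorm (X n) \<le> e"
  shows "vnorm L \<le> e"
  using Lim_dist_ubound [of sequentially X L 0 e] assms
  by (simp add: dist_vnorm dist_commute [of 0] trivial_limit_sequentially)

lemma vnorm_suminf_tail_le: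
  fixes f :: "nat \<Rightarrow> 'a::complete_nonarch_field"
  assumes f: "f \<longlonglongrightarrow> 0" and e: "\<And>k. k \<ge> K \<Longrightarrow> vnorm (f k) \<le> e"
  shows "vnorm (suminf f - sum f {..<K}) \<le> e"
proof (rule vnorm_limit_le)
  show "(\<lambda>n. sum f {..<n} - sum f {..<K}) \<longlonglongrightarrow> suminf f - sum f {..<K}"
    by (intro tendsto_intros summable_LIMSEQ summable_nonarch f)
  have e0: "e \<ge> 0"
    using e [of K] vnorm_nonneg [of "f K"] by linarith
  show "\<forall>\<^sub>F n in sequentially. vnorm (sum f {..<n} - sum f {..<K}) \<le> e"
    using eventually_ge_at_top [of K]
  proof eventually_elim
    case (elim n)
    have "sum f {..<n} - sum f {..<K} = sum f {K..<n}"
      using sum_diff_nat_ivl [of 0 K n f] elim by (simp add: atLeast0LessThan)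
    then show ?case
      using e e0 by (auto intro: vnorm_sum_le)
  qed
qed

section \<open>Density of the natural numbers and Mahler series\<close>

text \<open>The analysis takes place in any complete field whose absolute value extends the
  \<open>p\<close>-adic one; the \<open>p\<close>-adic complex numbers are such a field. The parameter \<open>p\<close> does not determine the field, so
  its type is a parameter as well.\<close>

locale p_adic_valued_field =
  fixes p :: nat and field_type :: "'a::complete_nonarch_field itself"
  assumes prime_p: "prime p"
    and vnorm_of_int:
      "\<And>k. k \<noteq> 0 \<Longrightarrow> vnorm (of_int k :: 'a) = (1 / real p) ^ multiplicity (int p) k"
begin

lemma p_gt_1: "p > 1"
  using prime_p by (rule prime_gt_1_nat)

lemma vnorm_p: "vnorm (of_nat p :: 'a) = 1 / p"
proof -
  have "multiplicity (int p) (int p) = 1"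
    using prime_p by (intro multiplicity_self) auto
  then show ?thesis
    using vnorm_of_int [of "int p"] p_gt_1 by simp
qed

lemma vnorm_p_power: "vnorm (of_nat (p ^ N) :: 'a) = (1 / p) ^ N"
  by (simp add: vnorm_power vnorm_p)

lemma inverse_p_power_LIMSEQ_0: "(\<lambda>N. (1 / real p) ^ N) \<longlonglongrightarrow> 0"
  using p_gt_1 by (intro LIMSEQ_power_zero) simp

lemma p_power_LIMSEQ_0: "(\<lambda>N. of_nat (p ^ N) :: 'a) \<longlonglongrightarrow> 0"
  unfolding tendsto_vnorm_iff diff_0_right vnorm_p_power by (rule inverse_p_power_LIMSEQ_0)

text \<open>The power of \<open>p\<close> dividing \<open>m\<close> is at most \<open>m\<close>. This bounds the denominators in the
  logarithm series.\<close>

lemma vnorm_of_nat_lower: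
  assumes "m > 0"
  shows "1 / real m \<le> vnorm (of_nat m :: 'a)"
proof -
  have "int p ^ multiplicity (int p) (int m) \<le> int m"
    using assms by (intro zdvd_imp_le multiplicity_dvd) auto
  then have "real p ^ multiplicity (int p) (int m) \<le> real m"
    by (metis of_nat_le_iff of_nat_power)
  then show ?thesis
    using vnorm_of_int [of "int m"] assms p_gt_1
    by (simp add: power_divide frac_le)
qed

lemma vnorm_of_int_le_1: "vnorm (of_int k :: 'a) \<le> 1"
  by (cases k rule: int_cases2) (simp_all add: vnorm_of_nat_le_1)

lemma vnorm_of_int_dvd:
  assumes "int p ^ N dvd a"
  shows "vnorm (of_int a :: 'a) \<le> (1 / p) ^ N"
proof -
  obtain c where "a = int p ^ N * c"
    using assms by blast
  then have "vnorm (of_int a :: 'a) = (1 / p) ^ N * vnorm (of_int c :: 'a)"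
    by (simp add: vnorm_mult vnorm_power vnorm_p)
  also have "\<dots> \<le> (1 / p) ^ N * 1"
    by (intro mult_left_mono vnorm_of_int_le_1) simp
  finally show ?thesis by simp
qed

lemma vnorm_of_int_not_dvd:
  assumes "\<not> int p dvd b"
  shows "vnorm (of_int b :: 'a) = 1"
  using vnorm_of_int [of b] assms by (cases "b = 0") (simp_all add: not_dvd_imp_multiplicity_0)

text \<open>Write the rational number as \<open>a / b\<close> in lowest terms. Integrality forces \<open>p\<close> not to divide
  \<open>b\<close>, so \<open>b\<close> is invertible modulo every \<open>p ^ N\<close>, and a residue \<open>m\<close> of \<open>a / b\<close> modulo
  \<open>p ^ N\<close> is within \<open>1 / p ^ N\<close> of it.\<close>

lemma of_rat_approx_of_nat:
  assumes x: "vnorm (of_rat x :: 'a) \<le> 1" and e: "e > 0"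
  obtains m :: nat where "vnorm (of_rat x - of_nat m :: 'a) < e"
proof -
  obtain a b where "quotient_of x = (a, b)"
    by fastforce
  then have b: "b > 0" and cop: "coprime a b" and "x = of_int a / of_int b"
    by (auto simp: quotient_of_denom_pos quotient_of_coprime quotient_of_div)
  then have xab: "of_rat x = (of_int a / of_int b :: 'a)"
    by (simp add: of_rat_divide)
  have ndvd: "\<not> int p dvd b"
  proof
    assume dvd: "int p dvd b"
    then have "\<not> int p dvd a"
      using cop prime_p by (metis coprime_common_divisor not_prime_unit prime_int_nat_transfer nat_int zero_le_imp_eq_int of_nat_0_le_iff)
    then have "vnorm (of_int a :: 'a) = 1"
      by (rule vnorm_of_int_not_dvd)
    have "vnorm (of_int b :: 'a) \<le> 1 / p"
      using vnorm_of_int_dvd [of 1 b] dvd by simp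
    also have "1 / real p < 1"
      using p_gt_1 by simp
    finally have "vnorm (of_int b :: 'a) < 1" .
    moreover note \<open>vnorm (of_int a :: 'a) = 1\<close>
    moreover have "vnorm (of_int b :: 'a) > 0"
      using b by (simp add: vnorm_pos_iff)
    ultimately show False
      using x by (simp add: xab vnorm_divide)
  qed
  obtain N where N: "(1 / real p) ^ N < e"
    using order_tendstoD(2) [OF inverse_p_power_LIMSEQ_0 e]
    by (auto simp: eventually_sequentially)
  have "coprime b (int p ^ N)"
    using ndvd prime_p by (metis coprime_commute coprime_power_right_iff prime_imp_coprime prime_nat_int_transfer)
  then obtain c where c: "[b * c = 1] (mod int p ^ N)"
    using cong_solve_coprime_int by blast
  define m where "m = nat ((c * a) mod int p ^ N)"
  have m: "int m = (c * a) mod int p ^ N"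
    using p_gt_1 by (simp add: m_def)
  have "[b * int m = b * (c * a)] (mod int p ^ N)"
    unfolding m by (intro cong_mult cong_refl) (simp add: cong_def)
  also have "b * (c * a) = (b * c) * a"
    by simp
  also have "[(b * c) * a = 1 * a] (mod int p ^ N)"
    by (intro cong_mult c cong_refl)
  finally have "int p ^ N dvd (a - b * int m)"
    by (simp add: cong_iff_dvd_diff dvd_diff_commute)
  then have "vnorm (of_int (a - b * int m) :: 'a) < e"
    using vnorm_of_int_dvd N by fastforce
  moreover have "of_rat x - of_nat m = of_int (a - b * int m) / (of_int b :: 'a)"
    using b by (simp add: xab field_simps)
  ultimately have "vnorm (of_rat x - of_nat m :: 'a) < e"
    using ndvd by (simp add: vnorm_divide vnorm_of_int_not_dvd)
  then show thesis by (rule that)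
qed

lemma closed_Zp: "closed (Zp :: 'a set)"
proof -
  have "(Zp :: 'a set) = Qp \<inter> cball 0 1"
    by (auto simp: Zp_def dist_vnorm)
  then show ?thesis
    by (metis Qp_def closed_Int closed_cball closed_closure)
qed

lemma of_int_in_Zp: "(of_int k :: 'a) \<in> Zp"
proof -
  have "(of_int k :: 'a) = of_rat (of_int k)"
    by simp
  then have "(of_int k :: 'a) \<in> range of_rat"
    by blast
  then show ?thesis
    using closure_subset vnorm_of_int_le_1 unfolding Zp_def Qp_def by blast
qed

lemma of_nat_in_Zp: "(of_nat k :: 'a) \<in> Zp"
  using of_int_in_Zp [of "int k"] by simp

text \<open>This is how identities for natural exponents reach all \<open>p\<close>-adic integers: both sides
  only have to be continuous.\<close>

lemma Zp_eq_closure_of_nat: "Zp = closure (range of_nat :: 'a set)"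
proof
  show "closure (range of_nat) \<subseteq> (Zp :: 'a set)"
    by (intro closure_minimal closed_Zp) (auto intro: of_nat_in_Zp)
  show "(Zp :: 'a set) \<subseteq> closure (range of_nat)"
  proof
    fix x :: 'a assume x: "x \<in> Zp"
    show "x \<in> closure (range of_nat)"
      unfolding closure_approachable
    proof (intro allI impI)
      fix e :: real assume e: "e > 0"
      have "x \<in> closure (range of_rat)" and x1: "vnorm x \<le> 1"
        using x by (auto simp: Zp_def Qp_def)
      moreover have "min e 1 > 0"
        using e by simp
      \<comment> \<open>Within distance \<open>1\<close> of an integral element only integral rational numbers occur.\<close>
      ultimately obtain y where y: "vnorm (of_rat y - x) < min e 1"
        by (metis (no_types, lifting) closure_approachable dist_vnorm imageE)
      have "vnorm (of_rat y :: 'a) \<le> 1"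
        using vnorm_add_le [of "of_rat y - x" 1 x] x1 y by simp
      then obtain m where m: "vnorm (of_rat y - of_nat m :: 'a) < e"
        using of_rat_approx_of_nat e by metis
      have "dist (of_nat m) x < e"
        using vnorm_add_less [of "of_nat m - of_rat y" e "of_rat y - x"] m y
        by (simp add: dist_vnorm vnorm_minus_commute [of "of_nat m"])
      then show "\<exists>y\<in>range of_nat. dist y x < e"
        by blast
    qed
  qed
qed

lemma Zp_LIMSEQ_of_nat:
  assumes "x \<in> Zp"
  obtains s :: "nat \<Rightarrow> nat" where "(\<lambda>n. of_nat (s n) :: 'a) \<longlonglongrightarrow> x"
proof -
  from assms have "x \<in> closure (range of_nat)"
    by (simp add: Zp_eq_closure_of_nat)
  then obtain X where X: "\<forall>n. X n \<in> range of_nat" "X \<longlonglongrightarrow> x"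
    unfolding closure_sequential by blast
  then have "\<forall>n. \<exists>m. X n = of_nat m"
    by auto
  from choice [OF this] obtain s where "\<forall>n. X n = of_nat (s n)" ..
  then have "X = (\<lambda>n. of_nat (s n))"
    by auto
  with X(2) show thesis
    by (intro that [of s]) simp
qed

lemma Zp_LIMSEQ:
  assumes "\<And>n. X n \<in> Zp" and "X \<longlonglongrightarrow> (x :: 'a)"
  shows "x \<in> Zp"
  by (rule closed_sequentially [OF closed_Zp assms])

lemma Zp_add:
  assumes "x \<in> Zp" "y \<in> Zp"
  shows "x + y \<in> (Zp :: 'a set)"
proof -
  obtain s where s: "(\<lambda>n. of_nat (s n)) \<longlonglongrightarrow> x"
    by (rule Zp_LIMSEQ_of_nat [OF assms(1)])
  obtain t where t: "(\<lambda>n. of_nat (t n)) \<longlonglongrightarrow> y"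
    by (rule Zp_LIMSEQ_of_nat [OF assms(2)])
  have "(\<lambda>n. of_nat (s n + t n)) \<longlonglongrightarrow> x + y"
    using tendsto_add [OF s t] by simp
  then show ?thesis
    by (rule Zp_LIMSEQ [OF of_nat_in_Zp])
qed

lemma Zp_mult:
  assumes "x \<in> Zp" "y \<in> Zp"
  shows "x * y \<in> (Zp :: 'a set)"
proof -
  obtain s where s: "(\<lambda>n. of_nat (s n)) \<longlonglongrightarrow> x"
    by (rule Zp_LIMSEQ_of_nat [OF assms(1)])
  obtain t where t: "(\<lambda>n. of_nat (t n)) \<longlonglongrightarrow> y"
    by (rule Zp_LIMSEQ_of_nat [OF assms(2)])
  have "(\<lambda>n. of_nat (s n * t n)) \<longlonglongrightarrow> x * y"
    using tendsto_mult [OF s t] by simp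
  then show ?thesis
    by (rule Zp_LIMSEQ [OF of_nat_in_Zp])
qed

lemma Zp_sum: "(\<And>i. i \<in> A \<Longrightarrow> f i \<in> (Zp :: 'a set)) \<Longrightarrow> sum f A \<in> Zp"
proof (induction A rule: infinite_finite_induct)
qed (use of_nat_in_Zp [of 0] in \<open>auto intro: Zp_add\<close>)

lemma continuous_on_gbinomial: "continuous_on A (\<lambda>x::'a. x gchoose k)"
proof -
  have "continuous_on A (\<lambda>x::'a. (\<Prod>i = 0..<k. x + (- of_nat i)) * inverse (fact k))"
    by (intro continuous_intros)
  then show ?thesis
    by (simp add: gbinomial_prod_rev divide_inverse)
qed

text \<open>On natural numbers the binomial coefficients are integers, hence of absolute value at
  most \<open>1\<close>; by density and continuity the bound holds on all of \<open>Zp\<close>.\<close>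

lemma vnorm_gbinomial_le_1:
  assumes "x \<in> Zp"
  shows "vnorm (x gchoose k :: 'a) \<le> 1"
proof -
  obtain s where s: "(\<lambda>n. of_nat (s n)) \<longlonglongrightarrow> x"
    by (rule Zp_LIMSEQ_of_nat [OF assms])
  show ?thesis
  proof (rule vnorm_limit_le)
    show "(\<lambda>n. of_nat (s n) gchoose k) \<longlonglongrightarrow> x gchoose k"
      using continuous_on_tendsto_compose [OF continuous_on_gbinomial [of UNIV] s] by simp
    show "\<forall>\<^sub>F n in sequentially. vnorm (of_nat (s n) gchoose k :: 'a) \<le> 1"
      by (simp add: binomial_gbinomial [symmetric] vnorm_of_nat_le_1)
  qed
qed

text \<open>Both the \<open>p\<close>-adic power and the quotient whose limit is the \<open>p\<close>-adic logarithm are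
  series in the binomial polynomials. Treating them uniformly yields their continuity at once.\<close>

definition mahler_series :: "(nat \<Rightarrow> 'a) \<Rightarrow> 'a \<Rightarrow> 'a" where
  "mahler_series c x = (\<Sum>k. (x gchoose k) * c k)"

lemma vnorm_mahler_term_le:
  "x \<in> Zp \<Longrightarrow> vnorm ((x gchoose k) * c k) \<le> vnorm (c k :: 'a)"
  using vnorm_gbinomial_le_1 [of x k] by (simp add: vnorm_mult mult_left_le_one_le)

lemma mahler_terms_LIMSEQ_0:
  assumes "c \<longlonglongrightarrow> 0" and "x \<in> Zp"
  shows "(\<lambda>k. (x gchoose k) * c k) \<longlonglongrightarrow> (0 :: 'a)"
proof -
  have "(\<lambda>k. vnorm (c k)) \<longlonglongrightarrow> 0"
    using assms(1) by (simp add: tendsto_vnorm_iff)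
  then have "(\<lambda>k. vnorm ((x gchoose k) * c k)) \<longlonglongrightarrow> 0"
    by (rule Lim_null_comparison [rotated]) (use assms(2) vnorm_mahler_term_le in auto)
  then show ?thesis
    by (simp add: tendsto_vnorm_iff)
qed

lemma vnorm_mahler_series_tail_le:
  assumes "c \<longlonglongrightarrow> 0" and "x \<in> Zp" and "\<And>k. k \<ge> K \<Longrightarrow> vnorm (c k) \<le> e"
  shows "vnorm (mahler_series c x - (\<Sum>k<K. (x gchoose k) * c k)) \<le> e"
  unfolding mahler_series_def
proof (rule vnorm_suminf_tail_le)
  show "(\<lambda>k. (x gchoose k) * c k) \<longlonglongrightarrow> 0"
    using assms(1,2) by (rule mahler_terms_LIMSEQ_0)
  show "vnorm ((x gchoose k) * c k) \<le> e" if "k \<ge> K" for k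
    using vnorm_mahler_term_le [of x k c] assms(2) assms(3) [OF that] by simp
qed

text \<open>The partial sums are polynomials, and since binomial coefficients are bounded by \<open>1\<close> on
  \<open>Zp\<close> they converge uniformly there.\<close>

lemma continuous_on_mahler_series:
  assumes c: "c \<longlonglongrightarrow> 0"
  shows "continuous_on Zp (mahler_series c)"
proof (rule uniform_limit_theorem)
  show "\<forall>\<^sub>F K in sequentially. continuous_on Zp (\<lambda>x. \<Sum>k<K. (x gchoose k) * c k)"
    by (intro always_eventually allI continuous_intros continuous_on_gbinomial)
  show "uniform_limit Zp (\<lambda>K x. \<Sum>k<K. (x gchoose k) * c k) (mahler_series c) sequentially"
  proof (rule uniform_limitI)
    fix e :: real assume e: "e > 0"
    then obtain M where M: "\<And>k. k \<ge> M \<Longrightarrow> vnorm (c k) < e / 2"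
      using tendstoD [OF c, of "e / 2"] by (auto simp: eventually_sequentially dist_vnorm)
    show "\<forall>\<^sub>F K in sequentially. \<forall>x\<in>Zp. dist (\<Sum>k<K. (x gchoose k) * c k) (mahler_series c x) < e"
      using eventually_ge_at_top [of M]
    proof eventually_elim
      case (elim K)
      show ?case
      proof
        fix x :: 'a assume x: "x \<in> Zp"
        have "vnorm (mahler_series c x - (\<Sum>k<K. (x gchoose k) * c k)) \<le> e / 2"
          using M elim by (intro vnorm_mahler_series_tail_le c x) (force intro: less_imp_le)
        then show "dist (\<Sum>k<K. (x gchoose k) * c k) (mahler_series c x) < e"
          using e by (simp add: dist_vnorm vnorm_minus_commute [of "sum _ _"])
      qed
    qed
  qed
qed simp

lemma mahler_series_LIMSEQ:
  assumes "c \<longlonglongrightarrow> 0" and "X \<longlonglongrightarrow> x" and "\<And>n. X n \<in> Zp" and "x \<in> Zp"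
  shows "(\<lambda>n. mahler_series c (X n)) \<longlonglongrightarrow> mahler_series c x"
  using continuous_on_tendsto_compose [OF continuous_on_mahler_series [OF assms(1)] assms(2)] assms
  by simp

end

section \<open>Powers with p-adic exponents\<close>


lemma vnorm_power_LIMSEQ_0:
  fixes t :: "'a::complete_nonarch_field"
  assumes "vnorm t < 1"
  shows "(\<lambda>k. t ^ k) \<longlonglongrightarrow> 0"
  unfolding tendsto_vnorm_iff diff_0_right vnorm_power
  using assms by (intro LIMSEQ_power_zero) simp

lemma one_unit_power:
  fixes q :: "'a::complete_nonarch_field"
  assumes "vnorm (1 - q) < 1"
  shows "vnorm (1 - q ^ m) < 1"
proof (induction m)
  case (Suc m)
  have "vnorm q \<le> 1"
    using vnorm_diff_le [of 1 1 "1 - q"] assms by simp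
  then have "vnorm (q * (1 - q ^ m)) < 1"
    using Suc mult_right_mono [of "vnorm q" 1 "vnorm (1 - q ^ m)"] by (simp add: vnorm_mult)
  from vnorm_add_less [OF assms this] show ?case
    by (simp add: algebra_simps)
qed simp

context p_adic_valued_field
begin

lemma qpow_eq_mahler_series: "qpow q = mahler_series (\<lambda>k. (q - 1) ^ k :: 'a)"
  by (simp add: fun_eq_iff qpow_def mahler_series_def)

lemma qpow_LIMSEQ:
  assumes "vnorm (1 - q) < 1" and "X \<longlonglongrightarrow> x" and "\<And>n. X n \<in> Zp" and "x \<in> (Zp :: 'a set)"
  shows "(\<lambda>n. qpow q (X n)) \<longlonglongrightarrow> qpow q x"
  unfolding qpow_eq_mahler_series
  using assms
  by (intro mahler_series_LIMSEQ vnorm_power_LIMSEQ_0) (simp_all add: vnorm_minus_commute)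

lemma qpow_add:
  assumes q: "vnorm (1 - q) < 1" and x: "x \<in> Zp" and y: "y \<in> (Zp :: 'a set)"
  shows "qpow q (x + y) = qpow q x * qpow q y"
proof -
  obtain s where s: "(\<lambda>n. of_nat (s n)) \<longlonglongrightarrow> x"
    by (rule Zp_LIMSEQ_of_nat [OF x])
  obtain t where t: "(\<lambda>n. of_nat (t n)) \<longlonglongrightarrow> y"
    by (rule Zp_LIMSEQ_of_nat [OF y])
  have "(\<lambda>n. qpow q (of_nat (s n + t n))) \<longlonglongrightarrow> qpow q (x + y)"
    using tendsto_add [OF s t] by (intro qpow_LIMSEQ q of_nat_in_Zp Zp_add x y) simp
  moreover have "(\<lambda>n. qpow q (of_nat (s n)) * qpow q (of_nat (t n))) \<longlonglongrightarrow> qpow q x * qpow q y"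
    by (intro tendsto_mult qpow_LIMSEQ q of_nat_in_Zp x y s t)
  then have "(\<lambda>n. qpow q (of_nat (s n + t n))) \<longlonglongrightarrow> qpow q x * qpow q y"
    by (simp add: qpow_of_nat power_add del: of_nat_add)
  ultimately show ?thesis
    by (rule LIMSEQ_unique)
qed

lemma qpow_0 [simp]: "qpow q 0 = (1 :: 'a)"
  using qpow_of_nat [of q 0] by simp

lemma qpow_sum:
  assumes "vnorm (1 - q) < 1" and "finite A" and "\<And>i. i \<in> A \<Longrightarrow> f i \<in> (Zp :: 'a set)"
  shows "qpow q (sum f A) = (\<Prod>i\<in>A. qpow q (f i))"
  using assms(2,3) by induction (simp_all add: qpow_add assms(1) Zp_sum)

lemma qpow_of_nat_mult:
  assumes "vnorm (1 - q) < 1" and "x \<in> (Zp :: 'a set)"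
  shows "qpow q (of_nat m * x) = qpow q x ^ m"
  using qpow_sum [OF assms(1), of "{..<m}" "\<lambda>_. x"] assms(2) by simp

text \<open>Changing the base in this way is what allows the linear approximation below to be applied
  to the base \<open>q ^ (p ^ N)\<close>, which is close to \<open>1\<close>.\<close>

lemma qpow_power_base:
  assumes q: "vnorm (1 - q) < 1" and x: "x \<in> (Zp :: 'a set)"
  shows "qpow (q ^ m) x = qpow q x ^ m"
proof -
  obtain s where s: "(\<lambda>n. of_nat (s n)) \<longlonglongrightarrow> x"
    by (rule Zp_LIMSEQ_of_nat [OF x])
  have "(\<lambda>n. qpow (q ^ m) (of_nat (s n))) \<longlonglongrightarrow> qpow (q ^ m) x"
    by (intro qpow_LIMSEQ one_unit_power q of_nat_in_Zp x s)
  moreover have "(\<lambda>n. qpow q (of_nat (s n)) ^ m) \<longlonglongrightarrow> qpow q x ^ m"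
    by (intro tendsto_power_strong tendsto_const qpow_LIMSEQ q of_nat_in_Zp x s)
  then have "(\<lambda>n. qpow (q ^ m) (of_nat (s n))) \<longlonglongrightarrow> qpow q x ^ m"
    by (simp add: qpow_of_nat power_mult [symmetric] mult.commute)
  ultimately show ?thesis
    by (rule LIMSEQ_unique)
qed

text \<open>Since \<open>p ^ N\<close> tends to \<open>0\<close> in \<open>Zp\<close>, this is continuity of \<open>qpow q\<close> at \<open>0\<close>.\<close>

lemma power_p_power_LIMSEQ_1:
  assumes "vnorm (1 - q) < 1"
  shows "(\<lambda>N. q ^ (p ^ N)) \<longlonglongrightarrow> (1 :: 'a)"
  using qpow_LIMSEQ [OF assms p_power_LIMSEQ_0] of_nat_in_Zp of_nat_in_Zp [of 0]
  by (simp add: qpow_of_nat del: of_nat_power)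

text \<open>The first two terms of the binomial series of \<open>(1 + (a - 1)) ^ y\<close> are \<open>1 + y * (a - 1)\<close>,
  and all later terms are at most of the second order in \<open>a - 1\<close>.\<close>

lemma vnorm_qpow_linear_approx:
  assumes a: "vnorm (1 - a) < 1" and y: "y \<in> (Zp :: 'a set)"
  shows "vnorm (qpow a y - 1 - y * (a - 1)) \<le> (vnorm (a - 1))\<^sup>2"
proof -
  have a': "vnorm (a - 1) < 1"
    using a by (simp add: vnorm_minus_commute)
  have "vnorm (qpow a y - (\<Sum>k<2. (y gchoose k) * (a - 1) ^ k)) \<le> (vnorm (a - 1))\<^sup>2"
    unfolding qpow_eq_mahler_series
    using a' by (intro vnorm_mahler_series_tail_le y vnorm_power_LIMSEQ_0)
      (auto simp: vnorm_power intro: power_decreasing)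
  then show ?thesis
    by (simp add: numeral_2_eq_2 algebra_simps)
qed

end

section \<open>Limits along powers of p\<close>

locale p_adic_q = p_adic_valued_field p field_type
  for p and field_type :: "'a::complete_nonarch_field itself" +
  fixes q :: 'a
  assumes one_unit_q: "vnorm (1 - q) < 1"
    and not_root_of_unity: "k \<ge> 1 \<Longrightarrow> q ^ k \<noteq> 1"
begin

text \<open>Up to the factor \<open>1 / (q - 1)\<close> this is the normalising constant \<open>qnum q (p ^ N)\<close> of the
  \<open>q\<close>-integral sums.\<close>

definition qp_diff :: "nat \<Rightarrow> 'a" where
  "qp_diff N = q ^ (p ^ N) - 1"

lemma qp_diff_nonzero: "qp_diff N \<noteq> 0"
  using not_root_of_unity [of "p ^ N"] p_gt_1 by (simp add: qp_diff_def)

lemma qp_diff_LIMSEQ_0: "qp_diff \<longlonglongrightarrow> 0"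
  using tendsto_diff [OF power_p_power_LIMSEQ_1 [OF one_unit_q] tendsto_const [of 1]]
  by (simp add: qp_diff_def [abs_def])

text \<open>With \<open>a = q ^ (p ^ N)\<close> the numerator is \<open>qpow a y - 1\<close>, which agrees with \<open>y * (a - 1)\<close>
  up to second order; dividing by \<open>a - 1\<close> leaves an error that tends to \<open>0\<close>.\<close>

lemma qpow_diff_ratio_LIMSEQ:
  assumes y: "y \<in> Zp"
  shows "(\<lambda>N. (qpow q y ^ (p ^ N) - 1) / qp_diff N) \<longlonglongrightarrow> y"
  unfolding tendsto_vnorm_iff
proof (rule Lim_null_comparison)
  show "(\<lambda>N. vnorm (qp_diff N)) \<longlonglongrightarrow> 0"
    using qp_diff_LIMSEQ_0 by (simp add: tendsto_vnorm_iff)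
  show "\<forall>\<^sub>F N in sequentially. norm (vnorm ((qpow q y ^ p ^ N - 1) / qp_diff N - y)) \<le> vnorm (qp_diff N)"
  proof (rule always_eventually, rule allI)
    fix N
    have "(qpow q y ^ (p ^ N) - 1) / qp_diff N - y =
        (qpow (q ^ (p ^ N)) y - 1 - y * (q ^ (p ^ N) - 1)) / qp_diff N"
      using qp_diff_nonzero [of N] by (simp add: qpow_power_base one_unit_q y qp_diff_def field_simps)
    moreover have "vnorm (qpow (q ^ (p ^ N)) y - 1 - y * (q ^ (p ^ N) - 1)) \<le> (vnorm (qp_diff N))\<^sup>2"
      unfolding qp_diff_def by (intro vnorm_qpow_linear_approx one_unit_power one_unit_q y)
    ultimately show "norm (vnorm ((qpow q y ^ p ^ N - 1) / qp_diff N - y)) \<le> vnorm (qp_diff N)"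
      using qp_diff_nonzero [of N]
      by (simp add: vnorm_divide divide_le_eq power2_eq_square vnorm_pos_iff)
  qed
qed

text \<open>If \<open>qpow q y = 1\<close>, the sequence with limit \<open>y\<close> in the preceding lemma is identically \<open>0\<close>.
  Thus not being a root of unity, a condition on natural exponents, excludes all nonzero
  exponents in \<open>Zp\<close>.\<close>

lemma qpow_eq_1_iff:
  assumes y: "y \<in> Zp"
  shows "qpow q y = 1 \<longleftrightarrow> y = 0"
proof
  assume "qpow q y = 1"
  then have "(\<lambda>N. 0) \<longlonglongrightarrow> y"
    using qpow_diff_ratio_LIMSEQ [OF y] by simp
  then show "y = 0"
    by (simp add: LIMSEQ_const_iff)
qed simp

text \<open>The Mahler coefficients of the function \<open>y \<mapsto> (qpow q (y + 1) - 1) / (y + 1)\<close>, whose value at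
  \<open>y = - 1\<close> has to be read as the logarithm of \<open>q\<close>.\<close>

definition log_coeff :: "nat \<Rightarrow> 'a" where
  "log_coeff k = (q - 1) ^ Suc k / of_nat (Suc k)"

lemma log_coeff_LIMSEQ_0: "log_coeff \<longlonglongrightarrow> 0"
proof -
  define t where "t = vnorm (1 - q)"
  have t: "0 \<le> t" "t < 1"
    using one_unit_q by (simp_all add: t_def)
  have bound: "vnorm (log_coeff k) \<le> real (Suc k) * t ^ Suc k" for k
  proof -
    have "1 \<le> real (Suc k) * vnorm (of_nat (Suc k) :: 'a)"
      using vnorm_of_nat_lower [of "Suc k"] by (simp add: field_simps del: of_nat_Suc)
    then have "t ^ Suc k * 1 \<le> t ^ Suc k * (real (Suc k) * vnorm (of_nat (Suc k) :: 'a))"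
      using t by (intro mult_left_mono) auto
    moreover have "vnorm (of_nat (Suc k) :: 'a) > 0"
      by (simp add: vnorm_pos_iff del: of_nat_Suc)
    ultimately show ?thesis
      unfolding log_coeff_def vnorm_divide vnorm_power t_def vnorm_minus_commute [of q 1]
      by (simp add: divide_le_eq mult_ac del: of_nat_Suc power_Suc)
  qed
  have "(\<lambda>k. real (Suc k) * t ^ Suc k) \<longlonglongrightarrow> 0"
    using t by (intro LIMSEQ_Suc powser_times_n_limit_0) auto
  then have "(\<lambda>k. vnorm (log_coeff k)) \<longlonglongrightarrow> 0"
  proof (rule Lim_null_comparison [rotated])
    show "\<forall>\<^sub>F k in sequentially. norm (vnorm (log_coeff k)) \<le> real (Suc k) * t ^ Suc k"
      by (rule always_eventually, rule allI)
        (simp only: real_norm_def abs_of_nonneg [OF vnorm_nonneg] bound)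
  qed
  then show ?thesis
    unfolding tendsto_vnorm_iff diff_0_right .
qed

lemma mahler_series_log_coeff_minus_1: "mahler_series log_coeff (- 1) = padic_log q"
proof -
  have "((- 1 :: 'a) gchoose k) = (- 1) ^ k" for k
    using gbinomial_minus [of "1::'a" k] by (simp add: binomial_gbinomial [symmetric])
  then show ?thesis
    by (simp add: mahler_series_def padic_log_def log_coeff_def)
qed

text \<open>Multiplying by \<open>m\<close> turns \<open>((m - 1) gchoose k) / (k + 1)\<close> into \<open>m gchoose (k + 1)\<close>, and
  the binomial theorem sums the result.\<close>

lemma mahler_series_log_coeff_of_nat:
  assumes "m \<ge> 1"
  shows "of_nat m * mahler_series log_coeff (of_nat (m - 1)) = q ^ m - 1"
proof -
  define M where "M = m - 1"
  have m: "m = Suc M"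
    using assms by (simp add: M_def)
  have absorb: "(of_nat m :: 'a) * ((of_nat M gchoose k) / of_nat (Suc k)) = of_nat m gchoose Suc k" for k
    using gbinomial_factors [of "of_nat M :: 'a" k] by (simp add: m add.commute)
  have "mahler_series log_coeff (of_nat M) = (\<Sum>k\<le>M. (of_nat M gchoose k) * log_coeff k)"
    unfolding mahler_series_def
    by (rule suminf_finite) (auto simp: binomial_gbinomial [symmetric])
  then have "of_nat m * mahler_series log_coeff (of_nat M) =
      (\<Sum>k\<le>M. of_nat m * ((of_nat M gchoose k) / of_nat (Suc k)) * (q - 1) ^ Suc k)"
    by (simp add: sum_distrib_left log_coeff_def mult_ac)
  also have "\<dots> = (\<Sum>k\<le>M. of_nat (m choose Suc k) * (q - 1) ^ Suc k)"
    unfolding absorb by (simp add: binomial_gbinomial)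
  also have "\<dots> = (\<Sum>k\<le>m. of_nat (m choose k) * (q - 1) ^ k) - 1"
    unfolding m by (subst sum.atMost_Suc_shift) simp
  also have "\<dots> = q ^ m - 1"
    using binomial_ring [of "q - 1" 1 m] by simp
  finally show ?thesis
    by (simp add: M_def)
qed

text \<open>As \<open>N\<close> grows, \<open>p ^ N - 1\<close> tends to \<open>- 1\<close>, and the Mahler series with coefficients
  \<open>log_coeff\<close> is continuous.\<close>

lemma log_LIMSEQ: "(\<lambda>N. qp_diff N / of_nat (p ^ N)) \<longlonglongrightarrow> padic_log q"
proof -
  have pN: "p ^ N \<ge> 1" for N
    using p_gt_1 by simp
  have "(\<lambda>N. of_nat (p ^ N) - 1 :: 'a) \<longlonglongrightarrow> 0 - 1"
    by (intro tendsto_diff p_power_LIMSEQ_0 tendsto_const)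
  then have "(\<lambda>N. of_nat (p ^ N - 1) :: 'a) \<longlonglongrightarrow> - 1"
    using pN by (simp add: of_nat_diff)
  then have "(\<lambda>N. mahler_series log_coeff (of_nat (p ^ N - 1))) \<longlonglongrightarrow> mahler_series log_coeff (- 1)"
    using of_int_in_Zp [of "- 1"] by (intro mahler_series_LIMSEQ log_coeff_LIMSEQ_0 of_nat_in_Zp) simp_all
  moreover have "mahler_series log_coeff (of_nat (p ^ N - 1)) = qp_diff N / of_nat (p ^ N)" for N
    using mahler_series_log_coeff_of_nat [OF pN [of N]] p_gt_1 by (simp add: qp_diff_def field_simps)
  ultimately show ?thesis
    by (simp add: mahler_series_log_coeff_minus_1)
qed

text \<open>With \<open>h = qp_diff N\<close> one has \<open>qp_diff (Suc N) = (h + 1) ^ p - 1 = p * h + \<dots>\<close>, where the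
  omitted terms are at most \<open>(vnorm h)\<^sup>2\<close>. They are dominated by \<open>p * h\<close> once
  \<open>vnorm h < 1 / p\<close>.\<close>

lemma vnorm_qp_diff_Suc:
  assumes "vnorm (qp_diff N) < 1 / p"
  shows "vnorm (qp_diff (Suc N)) = vnorm (qp_diff N) / p"
proof -
  have pos: "vnorm (qp_diff N) > 0"
    using qp_diff_nonzero [of N] by (simp add: vnorm_pos_iff)
  have p1: "1 / real p < 1"
    using p_gt_1 by simp
  have "qp_diff (Suc N) = (qp_diff N + 1) ^ p - 1"
    by (simp add: qp_diff_def power_mult [symmetric] mult.commute)
  also have "(qp_diff N + 1) ^ p = (\<Sum>k\<le>p. of_nat (p choose k) * qp_diff N ^ k)"
    by (simp add: binomial_ring)
  also have "{..p} = insert 0 (insert 1 {2..p})"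
    using p_gt_1 by auto
  finally have "qp_diff (Suc N) - of_nat p * qp_diff N = (\<Sum>k=2..p. of_nat (p choose k) * qp_diff N ^ k)"
    by simp
  moreover have "vnorm (\<Sum>k=2..p. of_nat (p choose k) * qp_diff N ^ k) < vnorm (of_nat p * qp_diff N)"
  proof (rule vnorm_sum_less)
    show "0 < vnorm (of_nat p * qp_diff N)"
      using pos p_gt_1 by (simp add: vnorm_mult vnorm_p)
    fix k assume "k \<in> {2..p}"
    then have k: "2 \<le> k" by simp
    have "vnorm (of_nat (p choose k) * qp_diff N ^ k) \<le> 1 * vnorm (qp_diff N) ^ k"
      unfolding vnorm_mult vnorm_power by (intro mult_right_mono vnorm_of_nat_le_1) simp
    also have "\<dots> \<le> 1 * vnorm (qp_diff N) ^ 2"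
      using k assms p1 by (auto intro!: power_decreasing)
    also have "\<dots> < 1 / p * vnorm (qp_diff N)"
      using assms pos mult_strict_right_mono [of "vnorm (qp_diff N)" "1 / p" "vnorm (qp_diff N)"] by (simp add: power2_eq_square)
    finally show "vnorm (of_nat (p choose k) * qp_diff N ^ k) < vnorm (of_nat p * qp_diff N)"
      by (simp add: vnorm_mult vnorm_p)
  qed
  ultimately have "vnorm (qp_diff (Suc N)) = vnorm (of_nat p * qp_diff N)"
    by (intro vnorm_eqI) simp
  then show ?thesis
    by (simp add: vnorm_mult vnorm_p)
qed

text \<open>By the preceding lemma the absolute value of \<open>qp_diff N / p ^ N\<close> is eventually constant, and
  it is nonzero since \<open>q\<close> is not a root of unity; so the limit of these quotients, the
  logarithm, cannot vanish.\<close>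

lemma padic_log_nonzero: "padic_log q \<noteq> 0"
proof
  assume "padic_log q = 0"
  with log_LIMSEQ have "(\<lambda>N. qp_diff N / of_nat (p ^ N)) \<longlonglongrightarrow> 0"
    by (simp only:)
  then have lim: "(\<lambda>N. vnorm (qp_diff N / of_nat (p ^ N))) \<longlonglongrightarrow> 0"
    unfolding tendsto_vnorm_iff diff_0_right .
  have "1 / real p > 0"
    using p_gt_1 by simp
  then obtain M where M: "\<And>N. N \<ge> M \<Longrightarrow> vnorm (qp_diff N) < 1 / p"
    using tendstoD [OF qp_diff_LIMSEQ_0, of "1 / p"] by (auto simp: eventually_sequentially dist_vnorm)
  define C where "C = vnorm (qp_diff M / of_nat (p ^ M))"
  have const: "vnorm (qp_diff N / of_nat (p ^ N)) = C" if "N \<ge> M" for N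
    using that
  proof (induction N rule: dec_induct)
    case (step N)
    have "vnorm (qp_diff (Suc N) / of_nat (p ^ Suc N)) = vnorm (qp_diff N / of_nat (p ^ N))"
      using vnorm_qp_diff_Suc [OF M [OF step(1)]] p_gt_1
      by (simp add: vnorm_divide vnorm_mult vnorm_p vnorm_power)
    then show ?case
      using step by simp
  qed (simp add: C_def)
  have "(\<lambda>N. vnorm (qp_diff N / of_nat (p ^ N))) \<longlonglongrightarrow> C"
  proof (rule tendsto_eventually)
    show "\<forall>\<^sub>F N in sequentially. vnorm (qp_diff N / of_nat (p ^ N)) = C"
      unfolding eventually_sequentially using const by blast
  qed
  then have "C = 0"
    using lim by (rule LIMSEQ_unique)
  then show False
    using qp_diff_nonzero [of M] p_gt_1 by (simp add: C_def)
qed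

section \<open>The q-integral of exponentials\<close>

text \<open>The sums are geometric with ratio \<open>qpow q (c + 1)\<close>, the summand \<open>1\<close> coming from the weight
  \<open>q ^ t\<close> of the measure. The ratio is \<open>1\<close> exactly for \<open>c + 1 = 0\<close>, and there the value
  \<open>(q - 1) / padic_log q\<close> prescribed for \<open>0 / 0\<close> appears.\<close>

lemma q_integral_qpow_LIMSEQ:
  assumes c: "c \<in> Zp"
  shows "q_integral_sums p q (\<lambda>t. qpow q (c * t)) \<longlonglongrightarrow> num_over_qnum q (c + 1)"
proof -
  define a where "a = qpow q (c + 1)"
  have one: "(1 :: 'a) \<in> Zp"
    using of_nat_in_Zp [of 1] by simp
  have c1: "c + 1 \<in> Zp"
    by (intro Zp_add c one)
  have q1: "q \<noteq> 1"
    using not_root_of_unity [of 1] by simp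
  have power: "qpow q (c * of_nat k) * qpow q (of_nat k) = a ^ k" for k
  proof -
    have "qpow q (c * of_nat k) * qpow q (of_nat k) = qpow q (c * of_nat k + of_nat k)"
      by (intro qpow_add [symmetric] one_unit_q Zp_mult c of_nat_in_Zp)
    also have "c * of_nat k + of_nat k = of_nat k * (c + 1)"
      by (simp add: algebra_simps)
    finally show ?thesis
      unfolding a_def by (simp only: qpow_of_nat_mult [OF one_unit_q c1])
  qed
  have sums: "q_integral_sums p q (\<lambda>t. qpow q (c * t)) N = (q - 1) / qp_diff N * (\<Sum>k<p ^ N. a ^ k)" for N
  proof -
    have "1 / qnum q (of_nat (p ^ N)) = (1 - q) / (1 - q ^ (p ^ N))"
      unfolding qnum_def qpow_of_nat by simp
    also have "\<dots> = (q - 1) / qp_diff N"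
      unfolding qp_diff_def by (metis minus_diff_eq minus_divide_divide)
    finally show ?thesis
      unfolding q_integral_sums_def power by simp
  qed
  show ?thesis
  proof (cases "c + 1 = 0")
    case True
    then have "a = 1"
      by (simp add: a_def)
    then have "q_integral_sums p q (\<lambda>t. qpow q (c * t)) = (\<lambda>N. (q - 1) / (qp_diff N / of_nat (p ^ N)))"
      by (simp add: fun_eq_iff sums)
    moreover have "(\<lambda>N. (q - 1) / (qp_diff N / of_nat (p ^ N))) \<longlonglongrightarrow> (q - 1) / padic_log q"
      by (intro tendsto_divide_nonarch tendsto_const log_LIMSEQ padic_log_nonzero)
    ultimately show ?thesis
      by (simp add: num_over_qnum_def True)
  next
    case False
    then have a1: "a \<noteq> 1"
      using qpow_eq_1_iff [OF c1] by (simp add: a_def)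
    have "q_integral_sums p q (\<lambda>t. qpow q (c * t)) =
        (\<lambda>N. (a ^ (p ^ N) - 1) / qp_diff N * ((q - 1) / (a - 1)))"
      by (simp add: fun_eq_iff sums geometric_sum [OF a1])
    moreover have "(\<lambda>N. (a ^ (p ^ N) - 1) / qp_diff N * ((q - 1) / (a - 1))) \<longlonglongrightarrow>
        (c + 1) * ((q - 1) / (a - 1))"
      unfolding a_def by (intro tendsto_mult tendsto_const qpow_diff_ratio_LIMSEQ c1)
    moreover have "(c + 1) * ((q - 1) / (a - 1)) = num_over_qnum q (c + 1)"
    proof -
      have "(q - 1) / (a - 1) = (1 - q) / (1 - a)"
        by (metis minus_diff_eq minus_divide_divide)
      then show ?thesis
        using False by (simp add: num_over_qnum_def qnum_def a_def)
    qed
    ultimately show ?thesis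
      by (simp only:)
  qed
qed

lemma q_integral_qpow_sum:
  assumes c: "\<And>l. l \<in> A \<Longrightarrow> c l \<in> Zp"
    and g: "\<And>t. t \<in> Zp \<Longrightarrow> g t = (\<Sum>l\<in>A. D l * qpow q (c l * t))"
  shows "q_integrable p q g"
    and "q_integral p q g = (\<Sum>l\<in>A. D l * num_over_qnum q (c l + 1))"
proof -
  have "q_integral_sums p q g N =
      (\<Sum>l\<in>A. D l * q_integral_sums p q (\<lambda>t. qpow q (c l * t)) N)" for N
    unfolding q_integral_sums_def g [OF of_nat_in_Zp] sum_distrib_left sum_distrib_right
    by (subst sum.swap) (simp add: mult_ac)
  moreover have "(\<lambda>N. \<Sum>l\<in>A. D l * q_integral_sums p q (\<lambda>t. qpow q (c l * t)) N) \<longlonglongrightarrow>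
      (\<Sum>l\<in>A. D l * num_over_qnum q (c l + 1))"
    by (intro tendsto_sum tendsto_mult tendsto_const q_integral_qpow_LIMSEQ c)
  ultimately have lim: "q_integral_sums p q g \<longlonglongrightarrow> (\<Sum>l\<in>A. D l * num_over_qnum q (c l + 1))"
    by presburger
  show "q_integrable p q g"
    unfolding q_integrable_def convergent_def using lim by blast
  show "q_integral p q g = (\<Sum>l\<in>A. D l * num_over_qnum q (c l + 1))"
    unfolding q_integral_def using lim by (rule limI)
qed

text \<open>Each integration replaces one exponential factor by its integral. The statement describes
  the state after \<open>s\<close> of the \<open>r\<close> integrations, when the variables \<open>X (Suc s), \<dots>, X r\<close> are
  still present.\<close>

lemma q_integral_iter_qpow_sum:
  assumes c: "\<And>l j. l \<in> A \<Longrightarrow> c l j \<in> Zp"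
    and f: "\<And>X. (\<And>j. X j \<in> Zp) \<Longrightarrow> f X = (\<Sum>l\<in>A. C l * (\<Prod>j=1..r. qpow q (c l j * X j)))"
    and "s \<le> r" and "\<And>j. X j \<in> Zp"
  shows "q_integrable_iter p q s f X \<and>
    q_integral_iter p q s f X =
      (\<Sum>l\<in>A. C l * (\<Prod>j=1..s. num_over_qnum q (c l j + 1)) * (\<Prod>j=Suc s..r. qpow q (c l j * X j)))"
  using assms(3,4)
proof (induction s arbitrary: X)
  case 0
  then show ?case
    by (simp add: f)
next
  case (Suc s)
  let ?P = "\<lambda>s l. \<Prod>j=1..s. num_over_qnum q (c l j + 1)"
  let ?Q = "\<lambda>X s l. \<Prod>j=Suc s..r. qpow q (c l j * X j)"
  define g where "g t = q_integral_iter p q s f (X(Suc s := t))" for t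
  have upd: "q_integrable_iter p q s f (X(Suc s := t)) \<and>
      g t = (\<Sum>l\<in>A. C l * ?P s l * ?Q (X(Suc s := t)) s l)" if "t \<in> Zp" for t
    unfolding g_def using Suc.prems that by (intro Suc.IH) auto
  have Q: "?Q (X(Suc s := t)) s l = ?Q X (Suc s) l * qpow q (c l (Suc s) * t)" for t l
  proof -
    have "?Q (X(Suc s := t)) s l = qpow q (c l (Suc s) * t) * ?Q (X(Suc s := t)) (Suc s) l"
      using Suc.prems by (simp add: prod.atLeast_Suc_atMost)
    also have "?Q (X(Suc s := t)) (Suc s) l = ?Q X (Suc s) l"
      by (rule prod.cong) auto
    finally show ?thesis
      by (simp add: mult.commute)
  qed
  have g: "g t = (\<Sum>l\<in>A. (C l * ?P s l * ?Q X (Suc s) l) * qpow q (c l (Suc s) * t))" if "t \<in> Zp" for t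
    using upd [OF that] unfolding Q by (simp add: mult.assoc)
  have g_eq: "(\<lambda>t. q_integral_iter p q s f (X(Suc s := t))) = g"
    by (simp add: fun_eq_iff g_def)
  have "q_integrable p q g"
    by (rule q_integral_qpow_sum(1) [where c = "\<lambda>l. c l (Suc s)", OF c g])
  moreover have "q_integral p q g =
      (\<Sum>l\<in>A. (C l * ?P s l * ?Q X (Suc s) l) * num_over_qnum q (c l (Suc s) + 1))"
    by (rule q_integral_qpow_sum(2) [where c = "\<lambda>l. c l (Suc s)", OF c g])
  ultimately show ?case
    using upd by (simp add: g_eq mult_ac)
qed

text \<open>The binomial theorem for \<open>(1 - a) ^ n\<close>, where \<open>a\<close> is the power of \<open>q\<close> inside the bracket,
  followed by the functional equation of \<open>qpow\<close> on \<open>Zp\<close>, separates the variables.\<close>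

lemma barnes_integrand_expand:
  assumes w: "\<And>j. w j \<in> Zp" and x: "x \<in> Zp" and X: "\<And>j. X j \<in> Zp"
  shows "barnes_integrand q r n x w \<delta> X =
    (\<Sum>l=0..n. (1 / (1 - q) ^ n * (of_nat (n choose l) * (- 1) ^ l * qpow q (of_nat l * x))) *
      (\<Prod>j=1..r. qpow q ((of_nat l * w j + of_int (\<delta> j - 1)) * X j)))"
proof -
  let ?W = "\<Sum>j=1..r. w j * X j" and ?d = "\<Sum>j=1..r. of_int (\<delta> j - 1) * X j"
  have W: "?W \<in> Zp" and d: "?d \<in> Zp"
    by (intro Zp_sum Zp_mult w X of_int_in_Zp)+
  define a where "a = qpow q (?W + x)"
  have summand: "a ^ l * qpow q ?d = qpow q (of_nat l * x) *
      (\<Prod>j=1..r. qpow q ((of_nat l * w j + of_int (\<delta> j - 1)) * X j))" for l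
  proof -
    have "a ^ l * qpow q ?d = qpow q (of_nat l * (?W + x)) * qpow q ?d"
      unfolding a_def by (simp only: qpow_of_nat_mult one_unit_q Zp_add W x)
    also have "\<dots> = qpow q (of_nat l * (?W + x) + ?d)"
      by (intro qpow_add [symmetric] one_unit_q Zp_mult Zp_add of_nat_in_Zp W x d)
    also have "of_nat l * (?W + x) + ?d =
        of_nat l * x + (\<Sum>j=1..r. (of_nat l * w j + of_int (\<delta> j - 1)) * X j)"
      by (simp add: algebra_simps sum_distrib_left sum.distrib sum_subtractf)
    also have "qpow q \<dots> = qpow q (of_nat l * x) *
        qpow q (\<Sum>j=1..r. (of_nat l * w j + of_int (\<delta> j - 1)) * X j)"
      by (intro qpow_add one_unit_q Zp_sum Zp_mult Zp_add of_nat_in_Zp of_int_in_Zp w x X)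
    also have "qpow q (\<Sum>j=1..r. (of_nat l * w j + of_int (\<delta> j - 1)) * X j) =
        (\<Prod>j=1..r. qpow q ((of_nat l * w j + of_int (\<delta> j - 1)) * X j))"
      by (intro qpow_sum one_unit_q Zp_mult Zp_add of_nat_in_Zp of_int_in_Zp w X) simp
    finally show ?thesis .
  qed
  have "(1 - a) ^ n = (\<Sum>l=0..n. of_nat (n choose l) * (- 1) ^ l * a ^ l)"
    using binomial_ring [of "- a" 1 n] by (simp add: atMost_atLeast0 power_minus [of a] mult.assoc)
  then have "barnes_integrand q r n x w \<delta> X =
      (\<Sum>l=0..n. 1 / (1 - q) ^ n * (of_nat (n choose l) * (- 1) ^ l) * (a ^ l * qpow q ?d))"
    unfolding barnes_integrand_def qnum_def a_def [symmetric] power_divide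
    by (simp add: sum_distrib_left sum_distrib_right sum_divide_distrib mult_ac)
  then show ?thesis
    unfolding summand by (simp only: mult.assoc)
qed

text \<open>The explicit formula for arbitrary \<open>p\<close>-adic integers \<open>w j\<close> and integers \<open>\<delta> j\<close>. The
  \<open>- 1\<close> in the exponents of the integrand cancels against the weight of the measure.\<close>

theorem barnes_q_bernoulli_eq:
  assumes w: "\<And>j. w j \<in> Zp" and x: "x \<in> Zp"
  shows "barnes_q_bernoulli_exists p q r n x w \<delta>"
    and "barnes_q_bernoulli p q r n x w \<delta> =
      1 / (1 - q) ^ n *
        (\<Sum>l=0..n. of_nat (n choose l) * (- 1) ^ l * qpow q (of_nat l * x) *
          (\<Prod>j=1..r. num_over_qnum q (of_nat l * w j + of_int (\<delta> j))))"
proof -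
  have zero: "(0 :: 'a) \<in> Zp"
    using of_nat_in_Zp [of 0] by simp
  have iter: "q_integrable_iter p q r (barnes_integrand q r n x w \<delta>) (\<lambda>_. 0) \<and>
      q_integral_iter p q r (barnes_integrand q r n x w \<delta>) (\<lambda>_. 0) =
        (\<Sum>l=0..n. (1 / (1 - q) ^ n * (of_nat (n choose l) * (- 1) ^ l * qpow q (of_nat l * x))) *
          (\<Prod>j=1..r. num_over_qnum q ((of_nat l * w j + of_int (\<delta> j - 1)) + 1)) *
          (\<Prod>j=Suc r..r. qpow q ((of_nat l * w j + of_int (\<delta> j - 1)) * 0)))"
  proof (rule q_integral_iter_qpow_sum)
    show "of_nat l * w j + of_int (\<delta> j - 1) \<in> Zp" for l j
      by (intro Zp_add Zp_mult of_nat_in_Zp of_int_in_Zp w)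
    show "barnes_integrand q r n x w \<delta> X =
        (\<Sum>l=0..n. (1 / (1 - q) ^ n * (of_nat (n choose l) * (- 1) ^ l * qpow q (of_nat l * x))) *
          (\<Prod>j=1..r. qpow q ((of_nat l * w j + of_int (\<delta> j - 1)) * X j)))"
      if "\<And>j. X j \<in> Zp" for X
      using w x that by (rule barnes_integrand_expand)
  qed (simp_all add: zero)
  then show "barnes_q_bernoulli_exists p q r n x w \<delta>"
    by (simp add: barnes_q_bernoulli_exists_def)
  show "barnes_q_bernoulli p q r n x w \<delta> =
      1 / (1 - q) ^ n *
        (\<Sum>l=0..n. of_nat (n choose l) * (- 1) ^ l * qpow q (of_nat l * x) *
          (\<Prod>j=1..r. num_over_qnum q (of_nat l * w j + of_int (\<delta> j))))"
    unfolding barnes_q_bernoulli_def using iter by (simp add: sum_distrib_left mult_ac)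
qed

end

theorem theorem11:
  fixes p r n :: nat
    and q x w1 :: "'a::complete_nonarch_field"
    and \<delta>1 :: int
  assumes "prime p"
    and "is_padic_complex p TYPE('a)"
    and "vnorm (1 - q) < 1"
    and "\<forall>k::nat. k \<ge> 1 \<longrightarrow> q ^ k \<noteq> 1"
    and "w1 \<in> Zp"
    and "x \<in> Zp"
    and "r \<ge> 1"
  shows "barnes_q_bernoulli_exists p q r n x (\<lambda>j. w1) (\<lambda>j. \<delta>1 + int j - 1) \<and>
    barnes_q_bernoulli p q r n x (\<lambda>j. w1) (\<lambda>j. \<delta>1 + int j - 1) =
      1 / (1 - q) ^ n *
        (\<Sum>l=0..n. of_nat (n choose l) * (- 1) ^ l * qpow q (of_nat l * x) *
          binomial_ratio q (of_nat l * w1 + of_int \<delta>1 + of_nat r - 1) r)"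
proof -
  interpret p_adic_q p "TYPE('a)" q
    by unfold_locales (use assms(1-4) in \<open>auto simp: is_padic_complex_def\<close>)
  \<comment> \<open>The arguments \<open>l * w1 + \<delta>1 + j - 1\<close> for \<open>j = 1, \<dots>, r\<close> are the factors of the
    falling product of \<open>l * w1 + \<delta>1 + r - 1\<close>, in reverse order.\<close>
  have "binomial_ratio q (of_nat l * w1 + of_int \<delta>1 + of_nat r - 1) r =
      (\<Prod>j=1..r. num_over_qnum q (of_nat l * w1 + of_int (\<delta>1 + int j - 1)))" for l
    unfolding binomial_ratio_def
    by (rule prod.reindex_bij_witness [where i = "\<lambda>j. Suc r - j" and j = "\<lambda>j. Suc r - j"])
      (auto simp: of_nat_diff algebra_simps)
  then show ?thesis
    using barnes_q_bernoulli_eq [of "\<lambda>_. w1" x r n "\<lambda>j. \<delta>1 + int j - 1"] assms(5,6) by simp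
qed

end
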